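(* Let $f_1,f_2:\mathbb{R}^d\to\mathbb{R}$ be in $\mathcal{C}^2$, $x_0\in\mathbb{R}^d$, $\bar\Delta>0$, and for $i\in\{1,2\}$ let $\{\widetilde f_{i,\Delta}\}_{\Delta\in(0,\bar\Delta]}$ be a class of (twice differentiable) models of $f_i$. Assume $f_2(x)\ne0$ and $\widetilde f_{2,\Delta}(x)\ne0$ for all $\Delta\in(0,\bar\Delta]$ and $x\in B_\Delta(x_0)$, and put $F=f_1/f_2$, $\widetilde F_\Delta=\widetilde f_{1,\Delta}/\widetilde f_{2,\Delta}$. Suppose that for $i\in\{1,2\}$ the class $\{\widetilde f_{i,\Delta}\}_{(0,\bar\Delta]}$ provides order-$\infty$ function accuracy of $f_i$ at $x_0$ with constant $\kappa_i^f(x_0)=0$, order-$N_i^g$ gradient accuracy of $f_i$ at $x_0$ with constant $\kappa_i^g(x_0)$, and order-$N_i^h$ Hessian accuracy of $f_i$ at $x_0$ with constant $\kappa_i^h(x_0)$, where $N_i^g,N_i^h\ge0$. Let $N_F^{gh}=\min\{N_1^g,N_2^g,N_1^h,N_2^h\}$. Then for every $\Delta\in(0,\bar\Delta]$ $$\|\nabla^2F(x_0)-\nabla^2\widetilde F_\Delta(x_0)\|\le K_F^h(x_0)\Delta^{N_F^{gh}},$$ where $$\begin{aligned}K_F^h(x_0)=&\left|\frac1{f_2^2(x_0)}\right|(M_{\nabla f_2}(x_0)+M_{\nabla\widetilde f_2}(x_0))\kappa_1^g(x_0)\bar\Delta^{N_1^g-N_F^{gh}}\\&+\left[\left|\frac1{f_2^2(x_0)}\right|(M_{\nabla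 f_1}(x_0)+M_{\nabla\widetilde f_1}(x_0))+\left|\frac{2f_1(x_0)}{f_2^3(x_0)}\right|(M_{\nabla f_2}(x_0)+M_{\nabla\widetilde f_2}(x_0))\right]\kappa_2^g(x_0)\bar\Delta^{N_2^g-N_F^{gh}}\\&+\left|\frac1{f_2(x_0)}\right|\kappa_1^h(x_0)\bar\Delta^{N_1^h-N_F^{gh}}+\left|\frac{f_1(x_0)}{f_2^2(x_0)}\right|\kappa_2^h(x_0)\bar\Delta^{N_2^h-N_F^{gh}}.\end{aligned}$$ In particular, $\{\widetilde F_\Delta\}_{(0,\bar\Delta]}$ provides order-$N_F^{gh}$ Hessian accuracy of $F$ at $x_0$.
   Context: $\|\cdot\|$ is the Euclidean norm for vectors and the induced operator norm for matrices; $B_\Delta(x_0)$ is the closed ball of radius $\Delta$ centered at $x_0$. A class of models of $f:\mathbb{R}^d\to\mathbb{R}$ is a family of functions $\widetilde f_\Delta:\mathbb{R}^d\to\mathbb{R}$ indexed by $\Delta\in(0,\bar\Delta]$; when gradients or Hessians of models appear the models are understood to be differentiable, respectively twice differentiable. Order-$\infty$ function accuracy of $f$ at $x_0$ with constant $0$ means $\widetilde f_\Delta(x_0)=f(x_0)$ for all $\Delta\in(0,\bar\Delta]$. For real $N\ge0$ and $\kappa\ge0$, the class provides order-$N$ gradient (respectively Hessian) accuracy of $f$ at $x_0$ with constant $\kappa$ if $\|\nabla f(x_0)-\nabla\widetilde f_\Delta(x_0)\|\le\kappa\Delta^N$ (respectively $\|\nabla^2f(x_0)-\nabla^2\widetilde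 f_\Delta(x_0)\|\le\kappa\Delta^N$) for all $\Delta\in(0,\bar\Delta]$. Without mention of a constant, it is meant that some such $\kappa\ge0$ exists. The quotients $F,\widetilde F_\Delta$ are considered where the denominators are nonzero. Bounds: $M_{\nabla f_i}(x_0)$ denotes a number with $\|\nabla f_i(x)\|\le M_{\nabla f_i}(x_0)$ for all $x\in B_{\bar\Delta}(x_0)$; $M_{\nabla\widetilde f_i}(x_0)$ denotes a number with $\|\nabla\widetilde f_{i,\Delta}(x_0)\|\le M_{\nabla\widetilde f_i}(x_0)$ for all $\Delta\in(0,\bar\Delta]$ (it exists; one may take $\bar\Delta^{N_i^g}\kappa_i^g(x_0)+M_{\nabla f_i}(x_0)$). *)

theory Defs
  imports "HOL-Analysis.Analysis"
begin

definition grad :: "(real ^ 'd \<Rightarrow> real) \<Rightarrow> real ^ 'd \<Rightarrow> real ^ 'd" where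
  "grad f x = (THE D. GDERIV f x :> D)"

lemma GDERIV_grad_iff:
  fixes f :: "real ^ 'd \<Rightarrow> real"
  shows "GDERIV f x :> D \<longleftrightarrow> f differentiable (at x) \<and> grad f x = D"
proof -
  have uniq: "D1 = D2" if "GDERIV f x :> D1" "GDERIV f x :> D2" for D1 D2
    using has_derivative_unique[OF that[unfolded gderiv_def]]
    by (metis vector_eq_ldot)
  have ex: "\<exists>D. GDERIV f x :> D" if d: "f differentiable (at x)"
  proof -
    obtain f' where f': "(f has_derivative f') (at x)"
      using d unfolding differentiable_def by blast
    then interpret bounded_linear f'
      by (rule has_derivative_bounded_linear)
    have "f' h = h \<bullet> adjoint f' 1" for h
      using adjoint_works[of f' h 1] linear_axioms by (simp add: inner_commute)
    then show ?thesis
      using f' unfolding gderiv_def by (metis (no_types, lifting) ext)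
  qed
  show ?thesis
  proof
    assume "GDERIV f x :> D"
    then show "f differentiable (at x) \<and> grad f x = D"
      unfolding grad_def using uniq
      by (auto simp: gderiv_def differentiable_def intro!: the_equality)
  next
    assume r: "f differentiable (at x) \<and> grad f x = D"
    then obtain E where "GDERIV f x :> E" using ex by blast
    moreover from this have "grad f x = E"
      unfolding grad_def using uniq by (intro the_equality)
    ultimately show "GDERIV f x :> D" using r by simp
  qed
qed

definition hessian :: "(real ^ 'd \<Rightarrow> real) \<Rightarrow> real ^ 'd \<Rightarrow> real ^ 'd ^ 'd" where
  "hessian f x = jacobian (grad f) (at x)"

definition twice_differentiable_at :: "(real ^ 'd \<Rightarrow> real) \<Rightarrow> real ^ 'd \<Rightarrow> bool" where
  "twice_differentiable_at f x \<longleftrightarrow>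
     (\<forall>\<^sub>F y in nhds x. f differentiable (at y)) \<and> grad f differentiable (at x)"

definition C2 :: "(real ^ 'd \<Rightarrow> real) \<Rightarrow> bool" where
  "C2 f \<longleftrightarrow> (\<forall>x. twice_differentiable_at f x) \<and> continuous_on UNIV (hessian f)"

text \<open>The operator norm has to be spelled out, since the library norm on \<open>real ^ 'd ^ 'd\<close>
  is the Frobenius norm.\<close>

definition opnorm :: "real ^ 'd ^ 'd \<Rightarrow> real" where
  "opnorm A = onorm ((*v) A)"

text \<open>A class of models is a family \<open>m :: real \<Rightarrow> real ^ 'd \<Rightarrow> real\<close>, of which only the members
  \<open>m \<Delta>\<close> with \<open>\<Delta> \<in> {0<..\<Delta>max}\<close> matter. Because \<^const>\<open>grad\<close> and \<^const>\<open>hessian\<close> are total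
  functions with arbitrary values where no derivative exists, the gradient and Hessian accuracy
  predicates state explicitly that the derivatives they compare exist.\<close>

definition exact_function_accuracy ::
    "(real ^ 'd \<Rightarrow> real) \<Rightarrow> (real \<Rightarrow> real ^ 'd \<Rightarrow> real) \<Rightarrow> real ^ 'd \<Rightarrow> real \<Rightarrow> bool" where
  "exact_function_accuracy f m x0 \<Delta>max \<longleftrightarrow> (\<forall>\<Delta>\<in>{0<..\<Delta>max}. m \<Delta> x0 = f x0)"

definition gradient_accuracy_const ::
    "(real ^ 'd \<Rightarrow> real) \<Rightarrow> (real \<Rightarrow> real ^ 'd \<Rightarrow> real) \<Rightarrow> real ^ 'd \<Rightarrow> real \<Rightarrow> real \<Rightarrow> real \<Rightarrow> bool"
where
  "gradient_accuracy_const f m x0 \<Delta>max N \<kappa> \<longleftrightarrow>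
     f differentiable (at x0) \<and>
     (\<forall>\<Delta>\<in>{0<..\<Delta>max}. m \<Delta> differentiable (at x0) \<and>
        norm (grad f x0 - grad (m \<Delta>) x0) \<le> \<kappa> * \<Delta> powr N)"

definition hessian_accuracy_const ::
    "(real ^ 'd \<Rightarrow> real) \<Rightarrow> (real \<Rightarrow> real ^ 'd \<Rightarrow> real) \<Rightarrow> real ^ 'd \<Rightarrow> real \<Rightarrow> real \<Rightarrow> real \<Rightarrow> bool"
where
  "hessian_accuracy_const f m x0 \<Delta>max N \<kappa> \<longleftrightarrow>
     twice_differentiable_at f x0 \<and>
     (\<forall>\<Delta>\<in>{0<..\<Delta>max}. twice_differentiable_at (m \<Delta>) x0 \<and>
        opnorm (hessian f x0 - hessian (m \<Delta>) x0) \<le> \<kappa> * \<Delta> powr N)"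

definition hessian_accuracy ::
    "(real ^ 'd \<Rightarrow> real) \<Rightarrow> (real \<Rightarrow> real ^ 'd \<Rightarrow> real) \<Rightarrow> real ^ 'd \<Rightarrow> real \<Rightarrow> real \<Rightarrow> bool" where
  "hessian_accuracy f m x0 \<Delta>max N \<longleftrightarrow> (\<exists>\<kappa>\<ge>0. hessian_accuracy_const f m x0 \<Delta>max N \<kappa>)"

end

(*
The Hessian of u / v at x0 is a polynomial expression in 1 / v, u and the gradients and Hessians
of u and v at x0. Since f and its models agree in value at x0, subtracting two such expressions
leaves the Hessian differences, weighted by 1 / v and u / v^2, and differences of rank-one terms
(b . h) a - (b' . h) a', each of which splits as ((b - b') . h) a + (b' . h) (a - a').
*)
theory Submission
  imports Defs
begin

lemma has_derivative_grad:
  fixes f :: "real ^ 'd \<Rightarrow> real"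
  assumes "f differentiable (at x)"
  shows "(f has_derivative (\<lambda>h. h \<bullet> grad f x)) (at x)"
  using assms GDERIV_grad_iff[of f x "grad f x"] by (simp add: gderiv_def)

text \<open>The quotient rule, written with powers of \<open>inverse (v x)\<close> so that a second
  differentiation involves only products, powers and the single derivative of
  \<open>inverse (v y)\<close>.\<close>

lemma grad_divide:
  fixes u v :: "real ^ 'd \<Rightarrow> real"
  assumes "u differentiable (at x)" "v differentiable (at x)" "v x \<noteq> 0"
  shows "(\<lambda>y. u y / v y) differentiable (at x)"
    and "grad (\<lambda>y. u y / v y) x = inverse (v x) *\<^sub>R grad u x - (u x * inverse (v x) ^ 2) *\<^sub>R grad v x"
proof -
  have "GDERIV (\<lambda>y. u y / v y) x :>
      inverse (v x) *\<^sub>R grad u x - (u x * inverse (v x) ^ 2) *\<^sub>R grad v x"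
    unfolding gderiv_def
    by (rule has_derivative_eq_rhs[OF has_derivative_divide'[OF
            has_derivative_grad[OF assms(1)] has_derivative_grad[OF assms(2)] assms(3)]])
      (use assms(3) in \<open>auto simp: fun_eq_iff inner_diff_right field_simps power2_eq_square\<close>)
  then show "(\<lambda>y. u y / v y) differentiable (at x)"
    and "grad (\<lambda>y. u y / v y) x = inverse (v x) *\<^sub>R grad u x - (u x * inverse (v x) ^ 2) *\<^sub>R grad v x"
    by (auto simp: GDERIV_grad_iff)
qed

lemma twice_differentiable_at_imp_differentiable:
  assumes "twice_differentiable_at f x"
  shows "f differentiable (at x)"
  using assms eventually_nhds_x_imp_x unfolding twice_differentiable_at_def by blast

lemma has_derivative_grad_hessian:
  assumes "twice_differentiable_at f x"
  shows "(grad f has_derivative (\<lambda>h. hessian f x *v h)) (at x)"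
  using assms jacobian_works unfolding twice_differentiable_at_def hessian_def by blast

text \<open>Near \<open>x\<close> the gradient of the quotient is the formula of
  \<open>grad_divide\<close>, and the product rule differentiates it once more. The Hessian is
  described by its action on \<open>h\<close> because its remaining terms have rank one:
  \<open>h\<close> is sent to \<open>(h \<bullet> b) *\<^sub>R a\<close>, the matrix being the outer
  product of \<open>a\<close> and \<open>b\<close>.\<close>

lemma hessian_divide:
  fixes u v :: "real ^ 'd \<Rightarrow> real"
  assumes u: "twice_differentiable_at u x" and v: "twice_differentiable_at v x" and nz: "v x \<noteq> 0"
  shows "twice_differentiable_at (\<lambda>y. u y / v y) x"
    and "hessian (\<lambda>y. u y / v y) x *v h =
      inverse (v x) *\<^sub>R (hessian u x *v h) - (u x * inverse (v x) ^ 2) *\<^sub>R (hessian v x *v h)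
      - inverse (v x) ^ 2 *\<^sub>R ((h \<bullet> grad v x) *\<^sub>R grad u x + (h \<bullet> grad u x) *\<^sub>R grad v x)
      + (2 * u x * inverse (v x) ^ 3 * (h \<bullet> grad v x)) *\<^sub>R grad v x"
proof -
  let ?q = "\<lambda>y. u y / v y"
  let ?g = "\<lambda>y. inverse (v y) *\<^sub>R grad u y - (u y * inverse (v y) ^ 2) *\<^sub>R grad v y"
  let ?D = "\<lambda>h. inverse (v x) *\<^sub>R (hessian u x *v h)
      - (u x * inverse (v x) ^ 2) *\<^sub>R (hessian v x *v h)
      - inverse (v x) ^ 2 *\<^sub>R ((h \<bullet> grad v x) *\<^sub>R grad u x + (h \<bullet> grad u x) *\<^sub>R grad v x)
      + (2 * u x * inverse (v x) ^ 3 * (h \<bullet> grad v x)) *\<^sub>R grad v x"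
  note du = has_derivative_grad[OF twice_differentiable_at_imp_differentiable[OF u]]
  note dv = has_derivative_grad[OF twice_differentiable_at_imp_differentiable[OF v]]
  \<comment> \<open>Differentiating the gradient at \<open>x\<close> requires its formula on a whole
    neighbourhood; continuity spreads \<open>v x \<noteq> 0\<close> to nearby points.\<close>
  have "isCont v x"
    using dv has_derivative_continuous by blast
  then have "\<forall>\<^sub>F y in nhds x. v y \<noteq> 0"
    using nz unfolding continuous_at tendsto_at_iff_tendsto_nhds by (rule tendsto_imp_eventually_ne)
  moreover have "\<forall>\<^sub>F y in nhds x. u differentiable (at y)"
    and "\<forall>\<^sub>F y in nhds x. v differentiable (at y)"
    using u v by (auto simp: twice_differentiable_at_def)
  ultimately have ev: "\<forall>\<^sub>F y in nhds x. ?q differentiable (at y) \<and> grad ?q y = ?g y"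
    by eventually_elim (simp add: grad_divide)
  have di: "((\<lambda>y. inverse (v y)) has_derivative (\<lambda>h. - (inverse (v x) * (h \<bullet> grad v x) * inverse (v x)))) (at x)"
    by (rule Deriv.has_derivative_inverse[OF nz dv])
  \<comment> \<open>The derivative of \<open>inverse (v y)\<close> yields the mixed term along
    \<open>grad u x\<close>. The derivative of \<open>u y * inverse (v y) ^ 2\<close> yields the
    mixed term along \<open>grad v x\<close> and, from the square, the term with factor 2 and the
    cube.\<close>
  have "(?g has_derivative ?D) (at x)"
    by (rule has_derivative_eq_rhs[OF has_derivative_diff[OF
            has_derivative_scaleR[OF di has_derivative_grad_hessian[OF u]]
            has_derivative_scaleR[OF has_derivative_mult[OF du has_derivative_power[OF di]]
              has_derivative_grad_hessian[OF v]]]])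
      (simp add: fun_eq_iff algebra_simps power2_eq_square power3_eq_cube)
  \<comment> \<open>\<open>ev\<close> gives agreement of \<open>?g\<close> and
    \<open>grad ?q\<close> on a punctured neighbourhood, and evaluated at \<open>x\<close> it gives
    agreement at the point itself; the transfer rule asks for both.\<close>
  then have D: "(grad ?q has_derivative ?D) (at x)"
    by (rule has_derivative_transform_eventually)
      (use ev eventually_nhds_x_imp_x[OF ev] in \<open>auto simp: eventually_at_filter elim: eventually_mono\<close>)
  then show *: "twice_differentiable_at ?q x"
    using ev unfolding twice_differentiable_at_def
    by (auto elim: eventually_mono simp: differentiable_def)
  show "hessian ?q x *v h = ?D h"
    using has_derivative_unique[OF has_derivative_grad_hessian[OF *] D] by metis
qed

lemma norm_mult_opnorm_le: "norm (A *v h) \<le> opnorm A * norm h"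
  unfolding opnorm_def by (rule onorm) (rule matrix_vector_mul_bounded_linear)

text \<open>The weights are deliberately mixed, \<open>norm a\<close> unprimed and
  \<open>norm b'\<close> primed. Adding the same bound with the roles of \<open>a\<close> and
  \<open>b\<close> exchanged makes each difference carry a symmetric weight, such as
  \<open>norm b + norm b'\<close> on \<open>norm (a - a')\<close>.\<close>

lemma norm_rank_one_diff_le:
  fixes a a' b b' h :: "'a::real_inner"
  shows "norm ((h \<bullet> b) *\<^sub>R a - (h \<bullet> b') *\<^sub>R a')
    \<le> (norm a * norm (b - b') + norm b' * norm (a - a')) * norm h"
proof -
  have "(h \<bullet> b) *\<^sub>R a - (h \<bullet> b') *\<^sub>R a' = (h \<bullet> (b - b')) *\<^sub>R a + (h \<bullet> b') *\<^sub>R (a - a')"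
    by (simp add: algebra_simps inner_diff_right)
  also have "norm \<dots> \<le> \<bar>h \<bullet> (b - b')\<bar> * norm a + \<bar>h \<bullet> b'\<bar> * norm (a - a')"
    by (metis norm_scaleR norm_triangle_ineq)
  also have "\<dots> \<le> (norm h * norm (b - b')) * norm a + (norm h * norm b') * norm (a - a')"
    by (intro add_mono mult_right_mono Cauchy_Schwarz_ineq2) auto
  finally show ?thesis
    by (simp add: algebra_simps)
qed

text \<open>The triangle inequality in the shape of a difference of two quotient Hessians:
  \<open>S\<close> and \<open>T\<close> stand for the Hessian differences, \<open>P\<close> and
  \<open>Q\<close> for the two mixed rank-one differences, \<open>W\<close> for the one involving
  only the denominator.\<close>

lemma norm_combination_le:
  fixes S T P Q W :: "'a::real_normed_vector"
  shows "norm (a *\<^sub>R S - b *\<^sub>R T - c *\<^sub>R (P + Q) + d *\<^sub>R W)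
    \<le> \<bar>a\<bar> * norm S + \<bar>b\<bar> * norm T + \<bar>c\<bar> * (norm P + norm Q) + \<bar>d\<bar> * norm W"
proof -
  have "norm (c *\<^sub>R (P + Q)) \<le> \<bar>c\<bar> * (norm P + norm Q)"
    by (simp add: mult_left_mono norm_triangle_ineq)
  then show ?thesis
    using norm_triangle_ineq[of "a *\<^sub>R S - b *\<^sub>R T - c *\<^sub>R (P + Q)" "d *\<^sub>R W"]
      norm_triangle_ineq4[of "a *\<^sub>R S - b *\<^sub>R T" "c *\<^sub>R (P + Q)"]
      norm_triangle_ineq4[of "a *\<^sub>R S" "b *\<^sub>R T"]
    by simp
qed

text \<open>Equal values at \<open>x\<close> give both quotient Hessians the same scalar
  coefficients, so only differences of gradients and Hessians survive. The bound concerns a single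
  model pair and is free of accuracy orders.\<close>

lemma opnorm_hessian_divide_diff_le:
  fixes u v u' v' :: "real ^ 'd \<Rightarrow> real"
  assumes u: "twice_differentiable_at u x" and v: "twice_differentiable_at v x"
    and u': "twice_differentiable_at u' x" and v': "twice_differentiable_at v' x"
    and nz: "v x \<noteq> 0" and eq: "u' x = u x" "v' x = v x"
  shows "opnorm (hessian (\<lambda>y. u y / v y) x - hessian (\<lambda>y. u' y / v' y) x) \<le>
    \<bar>1 / (v x)^2\<bar> * (norm (grad v x) + norm (grad v' x)) * norm (grad u x - grad u' x)
    + (\<bar>1 / (v x)^2\<bar> * (norm (grad u x) + norm (grad u' x))
       + \<bar>2 * u x / (v x)^3\<bar> * (norm (grad v x) + norm (grad v' x))) * norm (grad v x - grad v' x)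
    + \<bar>1 / v x\<bar> * opnorm (hessian u x - hessian u' x)
    + \<bar>u x / (v x)^2\<bar> * opnorm (hessian v x - hessian v' x)" (is "opnorm ?H \<le> ?C")
proof -
  have nz': "v' x \<noteq> 0"
    using nz eq by simp
  show ?thesis
    \<comment> \<open>Only the norm of \<open>?H\<close> is unfolded; the operator norms in
      \<open>?C\<close> stay folded for \<open>norm_mult_opnorm_le\<close>.\<close>
    unfolding opnorm_def[of ?H]
  proof (rule onorm_le)
    fix h :: "real ^ 'd"
    let ?r = "\<lambda>a b a' b'. (h \<bullet> b) *\<^sub>R a - (h \<bullet> b') *\<^sub>R a'"
    let ?a = "grad u x" and ?a' = "grad u' x" and ?b = "grad v x" and ?b' = "grad v' x"
    let ?S = "hessian u x - hessian u' x" and ?T = "hessian v x - hessian v' x"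
    have eq_H: "?H *v h = (1 / v x) *\<^sub>R (?S *v h) - (u x / (v x)^2) *\<^sub>R (?T *v h)
        - (1 / (v x)^2) *\<^sub>R (?r ?a ?b ?a' ?b' + ?r ?b ?a ?b' ?a')
        + (2 * u x / (v x)^3) *\<^sub>R ?r ?b ?b ?b' ?b'"
      unfolding matrix_vector_mult_diff_rdistrib hessian_divide(2)[OF u v nz]
        hessian_divide(2)[OF u' v' nz'] eq
      by (simp add: algebra_simps divide_inverse power_inverse)
    have "norm (?H *v h) \<le> \<bar>1 / v x\<bar> * norm (?S *v h) + \<bar>u x / (v x)^2\<bar> * norm (?T *v h)
        + \<bar>1 / (v x)^2\<bar> * (norm (?r ?a ?b ?a' ?b') + norm (?r ?b ?a ?b' ?a'))
        + \<bar>2 * u x / (v x)^3\<bar> * norm (?r ?b ?b ?b' ?b')"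
      unfolding eq_H by (rule norm_combination_le)
    also have "\<dots> \<le> \<bar>1 / v x\<bar> * (opnorm ?S * norm h) + \<bar>u x / (v x)^2\<bar> * (opnorm ?T * norm h)
        + \<bar>1 / (v x)^2\<bar> * ((norm ?a * norm (?b - ?b') + norm ?b' * norm (?a - ?a')) * norm h
            + (norm ?b * norm (?a - ?a') + norm ?a' * norm (?b - ?b')) * norm h)
        + \<bar>2 * u x / (v x)^3\<bar> * ((norm ?b * norm (?b - ?b') + norm ?b' * norm (?b - ?b')) * norm h)"
      by (intro add_mono mult_left_mono norm_mult_opnorm_le norm_rank_one_diff_le abs_ge_zero)
    \<comment> \<open>Collecting by gradient difference: the two mixed terms together produce the
      symmetric sums of gradient norms.\<close>
    also have "\<dots> = ?C * norm h"
      by (simp only: algebra_simps)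
    finally show "norm (?H *v h) \<le> ?C * norm h" .
  qed
qed

text \<open>Lowers an order \<open>p\<close> to a common order \<open>q\<close>: the surplus factor
  \<open>\<Delta> powr (p - q)\<close> has nonnegative exponent, so it is largest at
  \<open>R\<close>. This is the source of the powers of \<open>\<Delta>max\<close> in
  \<open>K\<close>.\<close>

lemma powr_le_powr_diff_mult:
  fixes \<Delta> R p q :: real
  assumes "0 < \<Delta>" "\<Delta> \<le> R" "q \<le> p"
  shows "\<Delta> powr p \<le> R powr (p - q) * \<Delta> powr q"
proof -
  have "\<Delta> powr p = \<Delta> powr (p - q) * \<Delta> powr q"
    by (simp flip: powr_add)
  also have "\<dots> \<le> R powr (p - q) * \<Delta> powr q"
    using assms by (intro mult_right_mono powr_mono2) auto
  finally show ?thesis .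
qed

theorem theorem25:
  fixes f :: "nat \<Rightarrow> real ^ 'd \<Rightarrow> real"
    and m :: "nat \<Rightarrow> real \<Rightarrow> real ^ 'd \<Rightarrow> real"
    and x0 :: "real ^ 'd"
    and \<Delta>max :: real
    and Ng Nh \<kappa>g \<kappa>h M Mm :: "nat \<Rightarrow> real"
    and F :: "real ^ 'd \<Rightarrow> real"
    and Fm :: "real \<Rightarrow> real ^ 'd \<Rightarrow> real"
    and N K :: real
  assumes "\<Delta>max > 0"
    and "\<And>i. i \<in> {1, 2} \<Longrightarrow> C2 (f i)"
    and "\<And>i \<Delta> x. i \<in> {1, 2} \<Longrightarrow> \<Delta> \<in> {0<..\<Delta>max} \<Longrightarrow> twice_differentiable_at (m i \<Delta>) x"
    and "\<And>\<Delta> x. \<Delta> \<in> {0<..\<Delta>max} \<Longrightarrow> x \<in> cball x0 \<Delta> \<Longrightarrow> f 2 x \<noteq> 0 \<and> m 2 \<Delta> x \<noteq> 0"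
    and "F = (\<lambda>x. f 1 x / f 2 x)"
    and "Fm = (\<lambda>\<Delta> x. m 1 \<Delta> x / m 2 \<Delta> x)"
    and "\<And>i. i \<in> {1, 2} \<Longrightarrow> Ng i \<ge> 0 \<and> Nh i \<ge> 0 \<and> \<kappa>g i \<ge> 0 \<and> \<kappa>h i \<ge> 0"
    and "\<And>i. i \<in> {1, 2} \<Longrightarrow> exact_function_accuracy (f i) (m i) x0 \<Delta>max"
    and "\<And>i. i \<in> {1, 2} \<Longrightarrow> gradient_accuracy_const (f i) (m i) x0 \<Delta>max (Ng i) (\<kappa>g i)"
    and "\<And>i. i \<in> {1, 2} \<Longrightarrow> hessian_accuracy_const (f i) (m i) x0 \<Delta>max (Nh i) (\<kappa>h i)"
    and "\<And>i x. i \<in> {1, 2} \<Longrightarrow> x \<in> cball x0 \<Delta>max \<Longrightarrow> norm (grad (f i) x) \<le> M i"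
    and "\<And>i \<Delta>. i \<in> {1, 2} \<Longrightarrow> \<Delta> \<in> {0<..\<Delta>max} \<Longrightarrow> norm (grad (m i \<Delta>) x0) \<le> Mm i"
    and "N = Min {Ng 1, Ng 2, Nh 1, Nh 2}"
    and "K = \<bar>1 / (f 2 x0)^2\<bar> * (M 2 + Mm 2) * \<kappa>g 1 * \<Delta>max powr (Ng 1 - N)
           + (\<bar>1 / (f 2 x0)^2\<bar> * (M 1 + Mm 1) + \<bar>2 * f 1 x0 / (f 2 x0)^3\<bar> * (M 2 + Mm 2))
               * \<kappa>g 2 * \<Delta>max powr (Ng 2 - N)
           + \<bar>1 / f 2 x0\<bar> * \<kappa>h 1 * \<Delta>max powr (Nh 1 - N)
           + \<bar>f 1 x0 / (f 2 x0)^2\<bar> * \<kappa>h 2 * \<Delta>max powr (Nh 2 - N)"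
  shows "(\<forall>\<Delta>\<in>{0<..\<Delta>max}. opnorm (hessian F x0 - hessian (Fm \<Delta>) x0) \<le> K * \<Delta> powr N)
       \<and> hessian_accuracy F Fm x0 \<Delta>max N"
proof -
  note C2 = assms(2) and nz = assms(4) and F = assms(5) and Fm = assms(6) and nonneg = assms(7)
    and exact = assms(8) and gacc = assms(9) and hacc = assms(10) and K = assms(14)
  have I: "1 \<in> {1, 2 :: nat}" "2 \<in> {1, 2 :: nat}"
    by auto
  \<comment> \<open>A concrete admissible radius, at which the hypotheses yield
    \<open>f 2 x0 \<noteq> 0\<close> and \<open>0 \<le> Mm i\<close>.\<close>
  have R: "\<Delta>max \<in> {0<..\<Delta>max}"
    using assms(1) by simp
  have f: "twice_differentiable_at (f i) x0" if "i \<in> {1, 2}" for i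
    using C2[OF that] by (simp add: C2_def)
  have nz2: "f 2 x0 \<noteq> 0"
    using nz[OF R, of x0] assms(1) by simp
  have Mf: "norm (grad (f i) x0) \<le> M i" if "i \<in> {1, 2}" for i
    using assms(11)[OF that] assms(1) by simp
  have M: "0 \<le> M i" "0 \<le> Mm i" if "i \<in> {1, 2}" for i
    using order_trans[OF norm_ge_zero Mf[OF that]]
      order_trans[OF norm_ge_zero assms(12)[OF that R]] by auto
  have NN: "N \<le> Ng i" "N \<le> Nh i" if "i \<in> {1, 2}" for i
    using that by (auto simp: assms(13))
  have main: "opnorm (hessian F x0 - hessian (Fm \<Delta>) x0) \<le> K * \<Delta> powr N"
    and Fm_diff: "twice_differentiable_at (Fm \<Delta>) x0" if \<Delta>: "\<Delta> \<in> {0<..\<Delta>max}" for \<Delta>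
  proof -
    have m: "m i \<Delta> x0 = f i x0" "twice_differentiable_at (m i \<Delta>) x0"
      "norm (grad (m i \<Delta>) x0) \<le> Mm i" if "i \<in> {1, 2}" for i
      using exact[OF that] assms(3)[OF that \<Delta>] assms(12)[OF that \<Delta>] \<Delta>
      by (auto simp: exact_function_accuracy_def)
    show "twice_differentiable_at (Fm \<Delta>) x0"
      unfolding Fm using hessian_divide(1)[OF m(2)[OF I(1)] m(2)[OF I(2)]] nz2 m(1)[OF I(2)] by simp
    have g: "norm (grad (f i) x0 - grad (m i \<Delta>) x0) \<le> \<kappa>g i * (\<Delta>max powr (Ng i - N) * \<Delta> powr N)"
      if i: "i \<in> {1, 2}" for i
    proof -
      have "norm (grad (f i) x0 - grad (m i \<Delta>) x0) \<le> \<kappa>g i * \<Delta> powr Ng i"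
        using gacc[OF i] \<Delta> by (auto simp: gradient_accuracy_const_def)
      also have "\<dots> \<le> \<kappa>g i * (\<Delta>max powr (Ng i - N) * \<Delta> powr N)"
        using \<Delta> nonneg[OF i] NN[OF i] by (intro mult_left_mono powr_le_powr_diff_mult) auto
      finally show ?thesis .
    qed
    have h: "opnorm (hessian (f i) x0 - hessian (m i \<Delta>) x0)
        \<le> \<kappa>h i * (\<Delta>max powr (Nh i - N) * \<Delta> powr N)" if i: "i \<in> {1, 2}" for i
    proof -
      have "opnorm (hessian (f i) x0 - hessian (m i \<Delta>) x0) \<le> \<kappa>h i * \<Delta> powr Nh i"
        using hacc[OF i] \<Delta> by (auto simp: hessian_accuracy_const_def)
      also have "\<dots> \<le> \<kappa>h i * (\<Delta>max powr (Nh i - N) * \<Delta> powr N)"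
        using \<Delta> nonneg[OF i] NN[OF i] by (intro mult_left_mono powr_le_powr_diff_mult) auto
      finally show ?thesis .
    qed
    have "opnorm (hessian F x0 - hessian (Fm \<Delta>) x0) \<le>
        \<bar>1 / (f 2 x0)^2\<bar> * (norm (grad (f 2) x0) + norm (grad (m 2 \<Delta>) x0))
          * norm (grad (f 1) x0 - grad (m 1 \<Delta>) x0)
        + (\<bar>1 / (f 2 x0)^2\<bar> * (norm (grad (f 1) x0) + norm (grad (m 1 \<Delta>) x0))
            + \<bar>2 * f 1 x0 / (f 2 x0)^3\<bar> * (norm (grad (f 2) x0) + norm (grad (m 2 \<Delta>) x0)))
          * norm (grad (f 2) x0 - grad (m 2 \<Delta>) x0)
        + \<bar>1 / f 2 x0\<bar> * opnorm (hessian (f 1) x0 - hessian (m 1 \<Delta>) x0)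
        + \<bar>f 1 x0 / (f 2 x0)^2\<bar> * opnorm (hessian (f 2) x0 - hessian (m 2 \<Delta>) x0)"
      unfolding F Fm
      by (rule opnorm_hessian_divide_diff_le) (use f m I nz2 in auto)
    also have "\<dots> \<le>
        \<bar>1 / (f 2 x0)^2\<bar> * (M 2 + Mm 2) * (\<kappa>g 1 * (\<Delta>max powr (Ng 1 - N) * \<Delta> powr N))
        + (\<bar>1 / (f 2 x0)^2\<bar> * (M 1 + Mm 1) + \<bar>2 * f 1 x0 / (f 2 x0)^3\<bar> * (M 2 + Mm 2))
          * (\<kappa>g 2 * (\<Delta>max powr (Ng 2 - N) * \<Delta> powr N))
        + \<bar>1 / f 2 x0\<bar> * (\<kappa>h 1 * (\<Delta>max powr (Nh 1 - N) * \<Delta> powr N))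
        + \<bar>f 1 x0 / (f 2 x0)^2\<bar> * (\<kappa>h 2 * (\<Delta>max powr (Nh 2 - N) * \<Delta> powr N))"
      \<comment> \<open>Monotonicity of products needs nonnegative factors: \<open>M\<close> covers
        the gradient bounds, \<open>onorm_pos_le\<close> the operator norms.\<close>
      by (intro add_mono mult_mono order_refl Mf m(3) g h I
          add_nonneg_nonneg mult_nonneg_nonneg M abs_ge_zero norm_ge_zero)
        (auto simp: opnorm_def intro!: onorm_pos_le matrix_vector_mul_bounded_linear)
    also have "\<dots> = K * \<Delta> powr N"
      unfolding K by (simp only: distrib_right mult.assoc)
    finally show "opnorm (hessian F x0 - hessian (Fm \<Delta>) x0) \<le> K * \<Delta> powr N" .
  qed
  \<comment> \<open>\<open>K\<close> is the witness for \<open>hessian_accuracy\<close>, which asks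
    for a nonnegative constant.\<close>
  have "0 \<le> K"
    unfolding K using nonneg[OF I(1)] nonneg[OF I(2)] M[OF I(1)] M[OF I(2)]
    by (intro add_nonneg_nonneg mult_nonneg_nonneg abs_ge_zero powr_ge_zero) auto
  moreover have "twice_differentiable_at F x0"
    unfolding F by (rule hessian_divide(1)[OF f[OF I(1)] f[OF I(2)] nz2])
  ultimately show ?thesis
    using main Fm_diff by (auto simp: hessian_accuracy_def hessian_accuracy_const_def)
qed

end
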